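(* Let $h_i:\mathbb{R}^n\to\overline{\mathbb{R}}$ be proper functions for $i\in\{1,\ldots,m\}$, and assume that $\bigcap_{i=1}^m\mathrm{dom}(h_i)\neq\emptyset$ and $\overline{x}\in\bigcap_{i=1}^m\arg\min_{\mathbb{R}^n}h_i$. Let $\alpha_i>0$ for all $i$, and define $h(x):=\sum_{i=1}^m\alpha_ih_i(x)$. Assume that each $h_i$ is $(\kappa_i,\gamma_i)$-strongly quasar-convex with respect to $\overline{x}$, where $\kappa_i\in(0,1]$ and $\gamma_i\ge 0$. Then $h$ is $(\kappa,\gamma)$-strongly quasar-convex with respect to $\overline{x}$, where $\kappa:=\min_{1\le i\le m}\kappa_i$ and $\gamma:=\frac{1}{\kappa}\sum_{i=1}^m\alpha_i\kappa_i\gamma_i$.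
   Context: $\overline{\mathbb{R}}=\mathbb{R}\cup\{+\infty\}$; $\mathrm{dom}(h)=\{x:h(x)<+\infty\}$; $h$ is proper if $\mathrm{dom}(h)\neq\emptyset$; $\|\cdot\|$ is the Euclidean norm. Let $\kappa\in(0,1]$, $\gamma\ge 0$. A proper function $h:\mathbb{R}^n\to\overline{\mathbb{R}}$ with convex domain and $\arg\min_{\mathbb{R}^n}h\neq\emptyset$ is called $(\kappa,\gamma)$-strongly quasar-convex with respect to $\overline{x}\in\arg\min_{\mathbb{R}^n}h$ if for all $x\in\mathrm{dom}(h)$ and all $\lambda\in[0,1]$, $$h(\lambda\overline{x}+(1-\lambda)x)\le\kappa\lambda h(\overline{x})+(1-\kappa\lambda)h(x)-\lambda\left(1-\frac{\lambda}{2-\kappa}\right)\frac{\kappa\gamma}{2}\|x-\overline{x}\|^2.$$ *)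

theory Defs
  imports "HOL-Analysis.Analysis"
begin

definition eff_dom :: "('a \<Rightarrow> ereal) \<Rightarrow> 'a set" where
  "eff_dom h = {x. h x < \<infinity>}"

text \<open>Functions with values in \<open>\<real> \<union> {+\<infinity>}\<close> are rendered as \<open>ereal\<close>-valued functions
  that never take the value \<open>-\<infinity>\<close>; this condition is part of properness.\<close>

definition proper_function :: "('a \<Rightarrow> ereal) \<Rightarrow> bool" where
  "proper_function h \<longleftrightarrow> (\<forall>x. h x \<noteq> -\<infinity>) \<and> eff_dom h \<noteq> {}"

definition argmin_set :: "('a \<Rightarrow> ereal) \<Rightarrow> 'a set" where
  "argmin_set h = {x. is_arg_min h (\<lambda>_. True) x}"

text \<open>In the inequality every term on the right-hand side is finite, because \<open>x\<close> lies in the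
  domain and \<open>xbar\<close> minimizes a proper function.\<close>

definition strongly_quasar_convex ::
    "real \<Rightarrow> real \<Rightarrow> ('a::euclidean_space \<Rightarrow> ereal) \<Rightarrow> 'a \<Rightarrow> bool" where
  "strongly_quasar_convex \<kappa> \<gamma> h xbar \<longleftrightarrow>
     0 < \<kappa> \<and> \<kappa> \<le> 1 \<and> 0 \<le> \<gamma> \<and>
     proper_function h \<and> convex (eff_dom h) \<and> xbar \<in> argmin_set h \<and>
     (\<forall>x\<in>eff_dom h. \<forall>t\<in>{0..1}.
        h (t *\<^sub>R xbar + (1 - t) *\<^sub>R x)
          \<le> ereal (\<kappa> * t) * h xbar + ereal (1 - \<kappa> * t) * h x
            - ereal (t * (1 - t / (2 - \<kappa>)) * (\<kappa> * \<gamma> / 2) * (norm (x - xbar))\<^sup>2))"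

end

theory Submission
  imports Defs
begin

text \<open>Since \<open>xbar\<close> minimizes every summand, a sum of strongly quasar-convex functions with one
  common parameter \<open>\<kappa>\<close> is handled by adding up the defining inequalities
  (\<open>strongly_quasar_convex_weighted_sum\<close>). The point of the proof is to pass from \<open>\<kappa> i\<close> to
  the common minimum without losing any of the modulus, that is, keeping the product \<open>\<kappa> * \<gamma>\<close>
  fixed (\<open>strongly_quasar_convex_decrease\<close>). This is not a termwise comparison: the factor
  \<open>1 - t / (2 - \<kappa>)\<close> grows when \<open>\<kappa>\<close> decreases, so the quadratic term to be subtracted gets
  larger.

  The loss is compensated by quadratic growth at the minimizer,
  \<open>h x - h xbar \<ge> \<kappa> * \<gamma> / (2 * (2 - \<kappa>)) * (norm (x - xbar))\<^sup>2\<close>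
  (\<open>strongly_quasar_convex_quadratic_growth\<close>). With \<open>P = \<kappa> * \<gamma> / 2 * (norm (x - xbar))\<^sup>2\<close>,
  replacing \<open>\<kappa>\<close> by \<open>\<kappa>' \<le> \<kappa>\<close> gains \<open>(\<kappa> - \<kappa>') * t * (h x - h xbar)\<close> in the linear
  part, which is at least \<open>(\<kappa> - \<kappa>') * t * P / (2 - \<kappa>)\<close>, whereas the quadratic term costs
  \<open>t\<^sup>2 * P * (\<kappa> - \<kappa>') / ((2 - \<kappa>) * (2 - \<kappa>'))\<close>; the gain dominates because
  \<open>t \<le> 1 \<le> 2 - \<kappa>'\<close>.\<close>

lemma argmin_set_iff:
  "x \<in> argmin_set h \<longleftrightarrow> (\<forall>y. h x \<le> h y)"
  by (simp add: argmin_set_def is_arg_min_linorder)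

lemma argmin_in_eff_dom:
  assumes "proper_function h" "x \<in> argmin_set h"
  shows "x \<in> eff_dom h"
  using assms by (auto simp: proper_function_def argmin_set_iff eff_dom_def intro: le_less_trans)

lemma ereal_real_on_eff_dom:
  assumes "proper_function h" "x \<in> eff_dom h"
  shows "h x = ereal (real_of_ereal (h x))"
  using assms by (cases "h x") (auto simp: proper_function_def eff_dom_def)

text \<open>All values in the defining inequality are finite, the left-hand side by convexity of the
  domain, so the inequality may be stated over the reals.\<close>

lemma strongly_quasar_convex_real_iff:
  "strongly_quasar_convex \<kappa> \<gamma> h xbar \<longleftrightarrow>
     0 < \<kappa> \<and> \<kappa> \<le> 1 \<and> 0 \<le> \<gamma> \<and>
     proper_function h \<and> convex (eff_dom h) \<and> xbar \<in> argmin_set h \<and>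
     (\<forall>x\<in>eff_dom h. \<forall>t\<in>{0..1}.
        real_of_ereal (h (t *\<^sub>R xbar + (1 - t) *\<^sub>R x))
          \<le> \<kappa> * t * real_of_ereal (h xbar) + (1 - \<kappa> * t) * real_of_ereal (h x)
            - t * (1 - t / (2 - \<kappa>)) * (\<kappa> * \<gamma> / 2) * (norm (x - xbar))\<^sup>2)"
proof -
  have "h (t *\<^sub>R xbar + (1 - t) *\<^sub>R x) \<le> ereal (\<kappa> * t) * h xbar + ereal (1 - \<kappa> * t) * h x - ereal q
    \<longleftrightarrow> real_of_ereal (h (t *\<^sub>R xbar + (1 - t) *\<^sub>R x))
          \<le> \<kappa> * t * real_of_ereal (h xbar) + (1 - \<kappa> * t) * real_of_ereal (h x) - q"
    if h: "proper_function h" "convex (eff_dom h)" "xbar \<in> argmin_set h"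
      and x: "x \<in> eff_dom h" and t: "t \<in> {0..1}" for x t q
  proof -
    have xbar: "xbar \<in> eff_dom h"
      by (rule argmin_in_eff_dom[OF h(1,3)])
    have y: "t *\<^sub>R xbar + (1 - t) *\<^sub>R x \<in> eff_dom h"
      using convexD[OF h(2) xbar x, of t "1 - t"] t by simp
    obtain a b c where "h (t *\<^sub>R xbar + (1 - t) *\<^sub>R x) = ereal a" "h xbar = ereal b" "h x = ereal c"
      using ereal_real_on_eff_dom[OF h(1) y] ereal_real_on_eff_dom[OF h(1) xbar]
        ereal_real_on_eff_dom[OF h(1) x] by blast
    then show ?thesis
      by simp
  qed
  then show ?thesis
    unfolding strongly_quasar_convex_def by (intro conj_cong refl ball_cong) simp_all
qed

lemma strongly_quasar_convex_quadratic_growth: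
  assumes sqc: "strongly_quasar_convex \<kappa> \<gamma> h xbar" and x: "x \<in> eff_dom h"
  shows "real_of_ereal (h xbar) + \<kappa> * \<gamma> / 2 * (norm (x - xbar))\<^sup>2 / (2 - \<kappa>) \<le> real_of_ereal (h x)"
proof -
  define P where "P = \<kappa> * \<gamma> / 2 * (norm (x - xbar))\<^sup>2"
  define D where "D = real_of_ereal (h x) - real_of_ereal (h xbar)"
  have \<kappa>: "0 < \<kappa>" "\<kappa> \<le> 1" and \<gamma>: "0 \<le> \<gamma>"
    and h: "proper_function h" "convex (eff_dom h)" "xbar \<in> argmin_set h"
    using sqc by (auto simp: strongly_quasar_convex_def)
  have xbar: "xbar \<in> eff_dom h"
    by (rule argmin_in_eff_dom[OF h(1,3)])
  have ineq: "t * (1 - t / (2 - \<kappa>)) * P \<le> (1 - \<kappa> * t) * D" if t: "t \<in> {0..1}" for t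
  proof -
    let ?y = "t *\<^sub>R xbar + (1 - t) *\<^sub>R x"
    have "?y \<in> eff_dom h"
      using convexD[OF h(2) xbar x, of t "1 - t"] t by simp
    moreover have "h xbar \<le> h ?y"
      using h(3) by (simp add: argmin_set_iff)
    ultimately have "real_of_ereal (h xbar) \<le> real_of_ereal (h ?y)"
      using ereal_real_on_eff_dom[OF h(1)] xbar by (metis ereal_less_eq(3))
    also have "\<dots> \<le> \<kappa> * t * real_of_ereal (h xbar) + (1 - \<kappa> * t) * real_of_ereal (h x)
        - t * (1 - t / (2 - \<kappa>)) * P"
      using sqc x t unfolding strongly_quasar_convex_real_iff P_def by (simp add: mult.assoc)
    finally show ?thesis
      by (simp add: D_def algebra_simps)
  qed
  have "P / (2 - \<kappa>) \<le> D"
  proof (cases "\<kappa> = 1")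
    case True
    \<comment> \<open>Here \<open>t = 1\<close> gives only \<open>0 \<le> 0\<close>; divide by \<open>1 - t\<close> and let \<open>t\<close> tend to 1.\<close>
    have "t * P \<le> D" if "0 < t" "t < 1" for t
    proof -
      have "(1 - t) * (t * P) \<le> (1 - t) * D"
        using ineq[of t] that True by (simp add: mult_ac)
      then show ?thesis
        using that by simp
    qed
    then show ?thesis
      using True field_le_mult_one_interval[of P D] by simp
  next
    case False
    have "(1 - \<kappa>) * (P / (2 - \<kappa>)) = (1 - 1 / (2 - \<kappa>)) * P"
      using \<kappa> by (simp add: field_simps)
    also have "\<dots> \<le> (1 - \<kappa>) * D"
      using ineq[of 1] by simp
    finally show ?thesis
      by (rule mult_left_le_imp_le) (use False \<kappa> in simp)
  qed
  then show ?thesis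
    by (simp add: P_def D_def)
qed

lemma strongly_quasar_convex_decrease:
  assumes sqc: "strongly_quasar_convex \<kappa> \<gamma> h xbar" and \<kappa>': "0 < \<kappa>'" "\<kappa>' \<le> \<kappa>"
  shows "strongly_quasar_convex \<kappa>' (\<kappa> * \<gamma> / \<kappa>') h xbar"
  unfolding strongly_quasar_convex_real_iff
proof (intro conjI ballI)
  have \<kappa>: "0 < \<kappa>" "\<kappa> \<le> 1" and \<gamma>: "0 \<le> \<gamma>"
    using sqc by (auto simp: strongly_quasar_convex_def)
  show "0 < \<kappa>'" "\<kappa>' \<le> 1" "0 \<le> \<kappa> * \<gamma> / \<kappa>'" "proper_function h" "convex (eff_dom h)"
    "xbar \<in> argmin_set h"
    using sqc \<kappa>' by (auto simp: strongly_quasar_convex_def)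
  fix x t
  assume x: "x \<in> eff_dom h" and "t \<in> {0..1::real}"
  then have t: "0 \<le> t" "t \<le> 1"
    by auto
  define P where "P = \<kappa> * \<gamma> / 2 * (norm (x - xbar))\<^sup>2"
  define a b where "a = real_of_ereal (h xbar)" and "b = real_of_ereal (h x)"
  have P: "P \<ge> 0"
    using \<kappa> \<gamma> by (simp add: P_def)
  have "real_of_ereal (h (t *\<^sub>R xbar + (1 - t) *\<^sub>R x))
      \<le> \<kappa> * t * a + (1 - \<kappa> * t) * b - t * (1 - t / (2 - \<kappa>)) * P"
    using sqc x t unfolding strongly_quasar_convex_real_iff P_def a_def b_def
    by (simp add: mult.assoc)
  also have "\<dots> \<le> \<kappa>' * t * a + (1 - \<kappa>' * t) * b - t * (1 - t / (2 - \<kappa>')) * P"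
  proof -
    have "t * P * (t / (2 - \<kappa>) - t / (2 - \<kappa>'))
        = t * (\<kappa> - \<kappa>') * (P / (2 - \<kappa>)) * (t / (2 - \<kappa>'))"
      using \<kappa> \<kappa>' by (simp add: field_simps)
    also have "\<dots> \<le> t * (\<kappa> - \<kappa>') * (P / (2 - \<kappa>))"
      using t \<kappa> \<kappa>' P by (intro mult_left_le mult_nonneg_nonneg) auto
    also have "\<dots> \<le> t * (\<kappa> - \<kappa>') * (b - a)"
      using strongly_quasar_convex_quadratic_growth[OF sqc x] t \<kappa>'
      by (intro mult_left_mono) (auto simp: P_def a_def b_def)
    finally show ?thesis
      by (simp add: algebra_simps)
  qed
  also have "t * (1 - t / (2 - \<kappa>')) * P
      = t * (1 - t / (2 - \<kappa>')) * (\<kappa>' * (\<kappa> * \<gamma> / \<kappa>') / 2) * (norm (x - xbar))\<^sup>2"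
    using \<kappa>' by (simp add: P_def)
  finally show "real_of_ereal (h (t *\<^sub>R xbar + (1 - t) *\<^sub>R x))
      \<le> \<kappa>' * t * real_of_ereal (h xbar) + (1 - \<kappa>' * t) * real_of_ereal (h x)
        - t * (1 - t / (2 - \<kappa>')) * (\<kappa>' * (\<kappa> * \<gamma> / \<kappa>') / 2) * (norm (x - xbar))\<^sup>2"
    by (simp add: a_def b_def)
qed

lemma eff_dom_weighted_sum:
  assumes "finite I" "\<And>i. i \<in> I \<Longrightarrow> proper_function (h i)" "\<And>i. i \<in> I \<Longrightarrow> 0 < \<alpha> i"
  shows "eff_dom (\<lambda>x. \<Sum>i\<in>I. ereal (\<alpha> i) * h i x) = (\<Inter>i\<in>I. eff_dom (h i))"
proof -
  have "ereal (\<alpha> i) * h i x = \<infinity> \<longleftrightarrow> h i x = \<infinity>" if "i \<in> I" for i x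
    using assms(2,3)[OF that] by (cases "h i x") (auto simp: proper_function_def)
  then show ?thesis
    using \<open>finite I\<close> by (auto simp: eff_dom_def sum_Pinfty less_top[symmetric] top_ereal_def)
qed

lemma real_of_ereal_weighted_sum:
  assumes "\<And>i. i \<in> I \<Longrightarrow> proper_function (h i)" "x \<in> (\<Inter>i\<in>I. eff_dom (h i))"
  shows "real_of_ereal (\<Sum>i\<in>I. ereal (\<alpha> i) * h i x) = (\<Sum>i\<in>I. \<alpha> i * real_of_ereal (h i x))"
proof -
  have "ereal (\<alpha> i) * h i x = ereal (\<alpha> i * real_of_ereal (h i x))" if "i \<in> I" for i
    using ereal_real_on_eff_dom[OF assms(1)[OF that], of x] assms(2) that
    by (metis INT_E times_ereal.simps(1))
  then show ?thesis
    by simp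
qed

lemma strongly_quasar_convex_weighted_sum:
  assumes I: "finite I" "I \<noteq> {}"
    and \<alpha>: "\<And>i. i \<in> I \<Longrightarrow> 0 < \<alpha> i"
    and sqc: "\<And>i. i \<in> I \<Longrightarrow> strongly_quasar_convex \<kappa> (\<gamma> i) (h i) xbar"
  shows "strongly_quasar_convex \<kappa> (\<Sum>i\<in>I. \<alpha> i * \<gamma> i) (\<lambda>x. \<Sum>i\<in>I. ereal (\<alpha> i) * h i x) xbar"
    (is "strongly_quasar_convex _ _ ?h _")
  unfolding strongly_quasar_convex_real_iff
proof (intro conjI ballI)
  have h: "proper_function (h i)" "convex (eff_dom (h i))" "xbar \<in> argmin_set (h i)" "0 \<le> \<gamma> i"
    if "i \<in> I" for i
    using sqc[OF that] by (auto simp: strongly_quasar_convex_def)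
  have dom: "eff_dom ?h = (\<Inter>i\<in>I. eff_dom (h i))"
    using I h \<alpha> by (intro eff_dom_weighted_sum)
  have xbar: "xbar \<in> eff_dom ?h"
    using argmin_in_eff_dom[OF h(1,3)] by (auto simp: dom)
  show "0 < \<kappa>" "\<kappa> \<le> 1"
    using sqc I by (auto simp: strongly_quasar_convex_def)
  show "0 \<le> (\<Sum>i\<in>I. \<alpha> i * \<gamma> i)"
    using \<alpha> h by (intro sum_nonneg mult_nonneg_nonneg) (auto intro: less_imp_le)
  have "ereal (\<alpha> i) * h i x \<noteq> -\<infinity>" if "i \<in> I" for i x
    using h(1)[OF that] \<alpha>[OF that] by (cases "h i x") (auto simp: proper_function_def)
  then have "?h x \<noteq> -\<infinity>" for x
    by (induction I rule: infinite_finite_induct) auto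
  then show "proper_function ?h"
    using xbar by (auto simp: proper_function_def)
  show conv: "convex (eff_dom ?h)"
    unfolding dom using h by (intro convex_INT)
  show "xbar \<in> argmin_set ?h"
    unfolding argmin_set_iff
    using h \<alpha> by (auto simp: argmin_set_iff less_imp_le intro!: sum_mono ereal_mult_left_mono)
  fix x t
  assume x: "x \<in> eff_dom ?h" and t: "t \<in> {0..1::real}"
  let ?y = "t *\<^sub>R xbar + (1 - t) *\<^sub>R x"
  define c where "c = t * (1 - t / (2 - \<kappa>)) * (norm (x - xbar))\<^sup>2 * \<kappa> / 2"
  have y: "?y \<in> eff_dom ?h"
    using convexD[OF conv xbar x, of t "1 - t"] t by simp
  have hreal: "real_of_ereal (?h z) = (\<Sum>i\<in>I. \<alpha> i * real_of_ereal (h i z))"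
    if "z \<in> eff_dom ?h" for z
    using that h unfolding dom by (intro real_of_ereal_weighted_sum)
  have "real_of_ereal (?h ?y) = (\<Sum>i\<in>I. \<alpha> i * real_of_ereal (h i ?y))"
    by (rule hreal[OF y])
  also have "\<dots> \<le> (\<Sum>i\<in>I. \<alpha> i * (\<kappa> * t * real_of_ereal (h i xbar)
      + (1 - \<kappa> * t) * real_of_ereal (h i x) - c * \<gamma> i))"
  proof (intro sum_mono mult_left_mono)
    fix i assume i: "i \<in> I"
    have "c * \<gamma> i = t * (1 - t / (2 - \<kappa>)) * (\<kappa> * \<gamma> i / 2) * (norm (x - xbar))\<^sup>2"
      by (simp add: c_def)
    moreover have "x \<in> eff_dom (h i)"
      using x i by (simp add: dom)
    ultimately show "real_of_ereal (h i ?y) \<le> \<kappa> * t * real_of_ereal (h i xbar)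
        + (1 - \<kappa> * t) * real_of_ereal (h i x) - c * \<gamma> i"
      using sqc[OF i] t unfolding strongly_quasar_convex_real_iff by (simp only:)
  qed (use \<alpha> less_imp_le in blast)
  also have "\<dots> = \<kappa> * t * (\<Sum>i\<in>I. \<alpha> i * real_of_ereal (h i xbar))
      + (1 - \<kappa> * t) * (\<Sum>i\<in>I. \<alpha> i * real_of_ereal (h i x)) - c * (\<Sum>i\<in>I. \<alpha> i * \<gamma> i)"
    by (simp add: sum_distrib_left sum.distrib sum_subtractf algebra_simps)
  finally show "real_of_ereal (?h ?y)
      \<le> \<kappa> * t * real_of_ereal (?h xbar) + (1 - \<kappa> * t) * real_of_ereal (?h x)
        - t * (1 - t / (2 - \<kappa>)) * (\<kappa> * (\<Sum>i\<in>I. \<alpha> i * \<gamma> i) / 2) * (norm (x - xbar))\<^sup>2"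
    by (simp only: hreal[OF x] hreal[OF xbar]) (simp add: c_def mult_ac)
qed

theorem proposition19:
  fixes h :: "nat \<Rightarrow> real ^ 'n \<Rightarrow> ereal"
    and \<alpha> \<kappa> \<gamma> :: "nat \<Rightarrow> real"
    and m :: nat
    and xbar :: "real ^ 'n"
  assumes "1 \<le> m"
    and "\<And>i. i \<in> {1..m} \<Longrightarrow> proper_function (h i)"
    and "(\<Inter>i\<in>{1..m}. eff_dom (h i)) \<noteq> {}"
    and "xbar \<in> (\<Inter>i\<in>{1..m}. argmin_set (h i))"
    and "\<And>i. i \<in> {1..m} \<Longrightarrow> 0 < \<alpha> i"
    and "\<And>i. i \<in> {1..m} \<Longrightarrow> 0 < \<kappa> i \<and> \<kappa> i \<le> 1"
    and "\<And>i. i \<in> {1..m} \<Longrightarrow> 0 \<le> \<gamma> i"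
    and "\<And>i. i \<in> {1..m} \<Longrightarrow> strongly_quasar_convex (\<kappa> i) (\<gamma> i) (h i) xbar"
  shows "let \<kappa>min = Min (\<kappa> ` {1..m});
             \<gamma>sum = 1 / \<kappa>min * (\<Sum>i=1..m. \<alpha> i * \<kappa> i * \<gamma> i)
         in strongly_quasar_convex \<kappa>min \<gamma>sum (\<lambda>x. \<Sum>i=1..m. ereal (\<alpha> i) * h i x) xbar"
proof -
  define \<kappa>min where "\<kappa>min = Min (\<kappa> ` {1..m})"
  have "\<kappa>min \<in> \<kappa> ` {1..m}"
    using assms(1) unfolding \<kappa>min_def by (intro Min_in) auto
  then have pos: "0 < \<kappa>min"
    using assms(6) by auto
  have "strongly_quasar_convex \<kappa>min (\<kappa> i * \<gamma> i / \<kappa>min) (h i) xbar" if "i \<in> {1..m}" for i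
    using strongly_quasar_convex_decrease[OF assms(8)[OF that] pos] that
    by (simp add: \<kappa>min_def)
  then have "strongly_quasar_convex \<kappa>min (\<Sum>i=1..m. \<alpha> i * (\<kappa> i * \<gamma> i / \<kappa>min))
      (\<lambda>x. \<Sum>i=1..m. ereal (\<alpha> i) * h i x) xbar"
    using assms(1,5) by (intro strongly_quasar_convex_weighted_sum) auto
  moreover have "(\<Sum>i=1..m. \<alpha> i * (\<kappa> i * \<gamma> i / \<kappa>min))
      = 1 / \<kappa>min * (\<Sum>i=1..m. \<alpha> i * \<kappa> i * \<gamma> i)"
    by (simp add: sum_divide_distrib mult_ac)
  ultimately show ?thesis
    by (simp add: Let_def \<kappa>min_def)
qed

end
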